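(* For any initial solution $\mathbf{x}^{(0)}\in\mathcal{X}$, the sequence $\{\mathbf{x}^{(k)}\}$ generated by the block coordinate descent algorithm (BCD, described in the context) for the problem $\min_{\mathbf{x}\in\mathcal{X}}E(\mathbf{x})$ converges to a discrete fixed point, i.e. to a point $\mathbf{x}^*\in\overline{\mathcal{X}}$ that is left unchanged by one full outer iteration of BCD.
   Context: Let $\mathcal{V}=\{1,\dots,n\}$ be a finite set of nodes; each node $i$ has a finite nonempty set of labels $\mathcal{S}_i$. Let $\mathcal{C}$ be a finite set of cliques; each clique is an ordered tuple $C=(i_1,\dots,i_\alpha)$ of distinct nodes, and the single nodes are among the cliques. For each $C\in\mathcal{C}$ let $\mathcal{S}_C=\prod_{i\in C}\mathcal{S}_i$ and let $f_C:\mathcal{S}_C\to\mathbb{R}$ be a real-valued potential function. A vector $\mathbf{x}=(\mathbf{x}_1,\dots,\mathbf{x}_n)$ consists of blocks $\mathbf{x}_i=(x_i(s))_{s\in\mathcal{S}_i}\in\mathbb{R}^{|\mathcal{S}_i|}$. The energy is $$E(\mathbf{x})=\sum_{C\in\mathcal{C}}\ \sum_{s_C\in\mathcal{S}_C} f_C(s_C)\prod_{j\in C}x_j(s_j),$$ where $s_j$ denotes the component of $s_C$ at node $j$. The feasible sets are $$\overline{\mathcal{X}}=\{\mathbf{x} : \mathbf{1}^\top\mathbf{x}_i=1,\ \mathbf{x}_i\in\{0,1\}^{|\mathcal{S}_i|}\ \forall i\in\mathcal{V}\},\qquad \mathcal{X}=\{\mathbf{x} : \mathbf{1}^\top\mathbf{x}_i=1,\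 \mathbf{x}_i\ge\mathbf{0}\ \forall i\in\mathcal{V}\}.$$ BCD algorithm. Start with $k=0$ and $\mathbf{x}^{(0)}\in\mathcal{X}$. In outer iteration $k$, for $i=1,2,\dots,n$ in this order, consider the block problem $$\min_{\mathbf{1}^\top\mathbf{x}_i=1,\ \mathbf{x}_i\ge\mathbf{0}} E(\mathbf{x}_1^{(k+1)},\dots,\mathbf{x}_{i-1}^{(k+1)},\mathbf{x}_i,\mathbf{x}_{i+1}^{(k)},\dots,\mathbf{x}_n^{(k)}),$$ whose objective is affine in $\mathbf{x}_i$, and which therefore always has a discrete optimal solution (one with all entries in $\{0,1\}$). If $\mathbf{x}_i^{(k)}$ is itself a discrete optimal solution of this block problem, set $\mathbf{x}_i^{(k+1)}=\mathbf{x}_i^{(k)}$; otherwise let $\mathbf{x}_i^{(k+1)}$ be any discrete optimal solution. Then increase $k$ by one and repeat until $\mathbf{x}^{(k+1)}=\mathbf{x}^{(k)}$. Once this happens the algorithm stops, and the sequence is regarded as constant from then on. *)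

theory Defs
  imports "HOL-Analysis.Analysis"
begin

text \<open>
  The block of a node with label set \<open>A\<close> is a function in \<open>extensional A\<close>, and a vector
  \<open>x\<close> is a function in \<open>extensional {1..n}\<close> of such blocks. Fixing all values outside the
  relevant finite index sets makes equality of functions coincide with equality of
  vectors, and the product topology on functions with the Euclidean one.
\<close>

definition block_simplex :: "'l set \<Rightarrow> ('l \<Rightarrow> real) set" where
  "block_simplex A = {y \<in> extensional A. (\<Sum>s\<in>A. y s) = 1 \<and> (\<forall>s\<in>A. 0 \<le> y s)}"

definition block_discrete :: "'l set \<Rightarrow> ('l \<Rightarrow> real) set" where
  "block_discrete A = {y \<in> extensional A. (\<Sum>s\<in>A. y s) = 1 \<and> (\<forall>s\<in>A. y s \<in> {0, 1})}"

definition feasible :: "nat \<Rightarrow> (nat \<Rightarrow> 'l set) \<Rightarrow> (nat \<Rightarrow> 'l \<Rightarrow> real) set" where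
  "feasible n S = (\<Pi>\<^sub>E i\<in>{1..n}. block_simplex (S i))"

definition feasible_discrete :: "nat \<Rightarrow> (nat \<Rightarrow> 'l set) \<Rightarrow> (nat \<Rightarrow> 'l \<Rightarrow> real) set" where
  "feasible_discrete n S = (\<Pi>\<^sub>E i\<in>{1..n}. block_discrete (S i))"

text \<open>
  A clique is a list \<open>C\<close> of distinct nodes. \<open>listset (map S C)\<close> is the product of the label
  sets along \<open>C\<close>, so the component of \<open>s\<close> at the node \<open>C ! k\<close> is \<open>s ! k\<close>.
\<close>

definition energy ::
  "(nat \<Rightarrow> 'l set) \<Rightarrow> nat list set \<Rightarrow> (nat list \<Rightarrow> 'l list \<Rightarrow> real) \<Rightarrow> (nat \<Rightarrow> 'l \<Rightarrow> real) \<Rightarrow> real"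
where
  "energy S \<C> f x =
    (\<Sum>C\<in>\<C>. \<Sum>s\<in>listset (map S C). f C s * (\<Prod>k<length C. x (C ! k) (s ! k)))"

text \<open>
  Discrete optimal solutions of the block problem at node \<open>i\<close>, the other blocks being those
  of \<open>z\<close>. The minimum is over the whole simplex; \<open>z i\<close> itself is irrelevant.
\<close>

definition discrete_block_solutions ::
  "(nat \<Rightarrow> 'l set) \<Rightarrow> nat list set \<Rightarrow> (nat list \<Rightarrow> 'l list \<Rightarrow> real) \<Rightarrow>
    (nat \<Rightarrow> 'l \<Rightarrow> real) \<Rightarrow> nat \<Rightarrow> ('l \<Rightarrow> real) set"
where
  "discrete_block_solutions S \<C> f z i =
    {y \<in> block_discrete (S i).
      is_arg_min (\<lambda>y'. energy S \<C> f (z(i := y'))) (\<lambda>y'. y' \<in> block_simplex (S i)) y}"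

text \<open>
  One full outer iteration may lead from \<open>x\<close> to \<open>x'\<close>; it is a relation because the choice
  among several discrete optimal solutions is free. When block \<open>i\<close> is treated, the blocks
  before \<open>i\<close> already have their new values.
\<close>

definition bcd_iteration ::
  "nat \<Rightarrow> (nat \<Rightarrow> 'l set) \<Rightarrow> nat list set \<Rightarrow> (nat list \<Rightarrow> 'l list \<Rightarrow> real) \<Rightarrow>
    (nat \<Rightarrow> 'l \<Rightarrow> real) \<Rightarrow> (nat \<Rightarrow> 'l \<Rightarrow> real) \<Rightarrow> bool"
where
  "bcd_iteration n S \<C> f x x' \<longleftrightarrow>
    x' \<in> extensional {1..n} \<and>
    (\<forall>i\<in>{1..n}.
      let sols = discrete_block_solutions S \<C> f (\<lambda>j. if j < i then x' j else x j) i
      in if x i \<in> sols then x' i = x i else x' i \<in> sols)"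

definition bcd_sequence ::
  "nat \<Rightarrow> (nat \<Rightarrow> 'l set) \<Rightarrow> nat list set \<Rightarrow> (nat list \<Rightarrow> 'l list \<Rightarrow> real) \<Rightarrow>
    (nat \<Rightarrow> nat \<Rightarrow> 'l \<Rightarrow> real) \<Rightarrow> bool"
where
  "bcd_sequence n S \<C> f x \<longleftrightarrow>
    (\<forall>k. if \<exists>m<k. x (Suc m) = x m then x (Suc k) = x k
         else bcd_iteration n S \<C> f (x k) (x (Suc k)))"

text \<open>
  Left unchanged by one outer iteration: the point itself is a possible outcome, and
  no choice of block solutions leads to a different one.
\<close>

definition bcd_fixed_point ::
  "nat \<Rightarrow> (nat \<Rightarrow> 'l set) \<Rightarrow> nat list set \<Rightarrow> (nat list \<Rightarrow> 'l list \<Rightarrow> real) \<Rightarrow>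
    (nat \<Rightarrow> 'l \<Rightarrow> real) \<Rightarrow> bool"
where
  "bcd_fixed_point n S \<C> f x \<longleftrightarrow> (\<forall>x'. bcd_iteration n S \<C> f x x' \<longleftrightarrow> x' = x)"

end

theory Submission
  imports Defs
begin

text \<open>
  After one outer iteration every iterate is discrete, so the sequence then lives in a finite
  set. Between discrete points an outer iteration never increases the energy, and it strictly
  decreases it if some block changes: the old block was feasible for the block problem and was
  given up only because it was not optimal. Hence the iterates cannot change forever. Once an
  iteration reproduces its input, every block of that point is a discrete optimal solution
  given all the others, so the algorithm has no freedom to leave it.
\<close>

lemma block_discrete_subset_simplex: "block_discrete A \<subseteq> block_simplex A"
  unfolding block_discrete_def block_simplex_def by force

lemma finite_block_discrete:
  assumes "finite A"
  shows "finite (block_discrete A)"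
proof (rule finite_subset)
  show "block_discrete A \<subseteq> (\<Pi>\<^sub>E s\<in>A. {0, 1})"
    unfolding block_discrete_def by (auto simp: extensional_def)
  show "finite (\<Pi>\<^sub>E s\<in>A. {0, 1::real})"
    using assms by (intro finite_PiE) auto
qed

lemma finite_feasible_discrete:
  assumes "\<And>i. i \<in> {1..n} \<Longrightarrow> finite (S i)"
  shows "finite (feasible_discrete n S)"
  unfolding feasible_discrete_def using assms
  by (intro finite_PiE finite_block_discrete) auto

lemma discrete_block_solutions_discrete:
  "y \<in> discrete_block_solutions S \<C> f z i \<Longrightarrow> y \<in> block_discrete (S i)"
  by (simp add: discrete_block_solutions_def)

lemma bcd_iterationD:
  assumes "bcd_iteration n S \<C> f x x'" "i \<in> {1..n}"
  defines "sols \<equiv> discrete_block_solutions S \<C> f (\<lambda>j. if j < i then x' j else x j) i"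
  shows "if x i \<in> sols then x' i = x i else x' i \<in> sols"
  using assms by (simp add: bcd_iteration_def Let_def)

lemma bcd_iteration_extensional:
  "bcd_iteration n S \<C> f x x' \<Longrightarrow> x' \<in> extensional {1..n}"
  by (simp add: bcd_iteration_def)

text \<open>Both branches of the update leave a discrete solution in block \<open>i\<close>, since a
  block is kept only when it is one. Hence even a fractional \<open>x\<close> becomes discrete after
  one pass.\<close>

lemma bcd_iteration_feasible_discrete:
  assumes "bcd_iteration n S \<C> f x x'"
  shows "x' \<in> feasible_discrete n S"
proof -
  have "x' i \<in> block_discrete (S i)" if "i \<in> {1..n}" for i
    using bcd_iterationD[OF assms that]
    by (auto split: if_splits dest: discrete_block_solutions_discrete)
  then show ?thesis
    using bcd_iteration_extensional[OF assms] by (simp add: feasible_discrete_def PiE_iff)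
qed

text \<open>\<open>z m\<close> is the vector just before node \<open>m\<close> is treated.
  Discreteness of \<open>x\<close> gives strictness: a fractional optimal block could be replaced at
  equal energy, a discrete one is replaced only if it is not optimal.\<close>

lemma bcd_iteration_block_energy:
  assumes iter: "bcd_iteration n S \<C> f x x'" and x: "x \<in> feasible_discrete n S"
    and i: "i \<in> {1..n}"
  defines "z \<equiv> \<lambda>m j. if j < m then x' j else x j"
  shows "energy S \<C> f (z (Suc i)) \<le> energy S \<C> f (z i)"
    and "x' i \<noteq> x i \<Longrightarrow> energy S \<C> f (z (Suc i)) < energy S \<C> f (z i)"
proof -
  have new: "(z i)(i := x' i) = z (Suc i)" and old: "(z i)(i := x i) = z i"
    by (auto simp: z_def fun_eq_iff less_Suc_eq)
  have xi: "x i \<in> block_discrete (S i)"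
    using x i by (auto simp: feasible_discrete_def)
  then have xi': "x i \<in> block_simplex (S i)"
    using block_discrete_subset_simplex by blast
  have strict: "energy S \<C> f (z (Suc i)) < energy S \<C> f (z i)" if "x' i \<noteq> x i"
  proof -
    from that have nsol: "x i \<notin> discrete_block_solutions S \<C> f (z i) i"
      and sol: "x' i \<in> discrete_block_solutions S \<C> f (z i) i"
      using bcd_iterationD[OF iter i] unfolding z_def by (simp_all split: if_splits)
    have le: "energy S \<C> f (z (Suc i)) \<le> energy S \<C> f ((z i)(i := y))"
      if "y \<in> block_simplex (S i)" for y
      using sol that unfolding discrete_block_solutions_def is_arg_min_linorder
      by (auto simp: new)
    \<comment> \<open>\<open>x i\<close> is discrete and lies in the simplex, so only minimality can
      have failed: some simplex point beats it, and the new block is at least as good as that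
      point.\<close>
    obtain y where "y \<in> block_simplex (S i)"
      "energy S \<C> f ((z i)(i := y)) < energy S \<C> f (z i)"
      using nsol xi xi' unfolding discrete_block_solutions_def is_arg_min_def
      by (auto simp: old)
    with le show ?thesis by fastforce
  qed
  then show "x' i \<noteq> x i \<Longrightarrow> energy S \<C> f (z (Suc i)) < energy S \<C> f (z i)" .
  show "energy S \<C> f (z (Suc i)) \<le> energy S \<C> f (z i)"
  proof (cases "x' i = x i")
    case True
    then show ?thesis using new old by simp
  next
    case False
    then show ?thesis using strict by simp
  qed
qed

lemma bcd_iteration_energy_less:
  assumes iter: "bcd_iteration n S \<C> f x x'" and x: "x \<in> feasible_discrete n S"
    and neq: "x' \<noteq> x"
  shows "energy S \<C> f x' < energy S \<C> f x"
proof -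
  define z where "z = (\<lambda>m j. if j < m then x' j else x j)"
  have ext: "x \<in> extensional {1..n}" "x' \<in> extensional {1..n}"
    using x bcd_iteration_extensional[OF iter] by (auto simp: feasible_discrete_def PiE_iff)
  \<comment> \<open>Nodes are numbered from 1, so \<open>z 1\<close> has replaced index 0 only;
    there, and beyond \<open>n\<close>, both vectors have the same default value.\<close>
  have first: "z 1 = x" and last: "z (Suc n) = x'"
    using ext by (auto simp: z_def fun_eq_iff extensional_def)
  have block: "energy S \<C> f (z (Suc i)) \<le> energy S \<C> f (z i)"
    "x' i \<noteq> x i \<Longrightarrow> energy S \<C> f (z (Suc i)) < energy S \<C> f (z i)" if "i \<in> {1..n}" for i
    using bcd_iteration_block_energy[OF iter x that] by (simp_all add: z_def)
  \<comment> \<open>The weak inequality is carried along so that a strict drop at one block survives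
    all the other blocks.\<close>
  have chain: "energy S \<C> f (z (Suc m)) \<le> energy S \<C> f (z 1) \<and>
      ((\<exists>i\<in>{1..m}. x' i \<noteq> x i) \<longrightarrow> energy S \<C> f (z (Suc m)) < energy S \<C> f (z 1))"
    if "m \<le> n" for m
    using that
  proof (induction m)
    case 0
    then show ?case by simp
  next
    case (Suc m)
    then have IH: "energy S \<C> f (z (Suc m)) \<le> energy S \<C> f (z 1)"
      "\<exists>i\<in>{1..m}. x' i \<noteq> x i \<Longrightarrow> energy S \<C> f (z (Suc m)) < energy S \<C> f (z 1)"
      by auto
    have "Suc m \<in> {1..n}"
      using Suc.prems by simp
    note step = block[OF this]
    have "energy S \<C> f (z (Suc (Suc m))) < energy S \<C> f (z 1)"
      if "i \<in> {1..Suc m}" "x' i \<noteq> x i" for i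
    proof (cases "i = Suc m")
      case True
      then show ?thesis using step(2) IH(1) that by simp
    next
      case False
      then have "i \<in> {1..m}" using that by simp
      then show ?thesis using step(1) IH(2) that by fastforce
    qed
    then show ?case using step(1) IH(1) by auto
  qed
  have "\<exists>i\<in>{1..n}. x' i \<noteq> x i"
    using neq ext extensionalityI by metis
  then show ?thesis
    using chain[of n] first last by simp
qed

text \<open>Strong induction in the order of treatment: as long as the earlier blocks are unchanged,
  the problem at \<open>i\<close> is the one that \<open>x i\<close> already solves, and the keep
  rule then forces \<open>x i\<close> even if there are ties.\<close>

lemma bcd_iteration_self_fixed_point:
  assumes self: "bcd_iteration n S \<C> f x x"
  shows "bcd_fixed_point n S \<C> f x"
  unfolding bcd_fixed_point_def
proof (intro allI iffI)
  fix x'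
  assume iter: "bcd_iteration n S \<C> f x x'"
  \<comment> \<open>Either branch gives membership: with output equal to input, rejecting
    \<open>x i\<close> would mean choosing it as a solution.\<close>
  have sol: "x i \<in> discrete_block_solutions S \<C> f x i" if "i \<in> {1..n}" for i
    using bcd_iterationD[OF self that] by (simp split: if_splits)
  have "i \<in> {1..n} \<longrightarrow> x' i = x i" for i
  proof (induction i rule: less_induct)
    case (less i)
    have "(\<lambda>j. if j < i then x' j else x j) = x" if "i \<in> {1..n}"
    proof
      fix j
      show "(if j < i then x' j else x j) = x j"
        using less[of j] that bcd_iteration_extensional[OF iter]
          bcd_iteration_extensional[OF self]
        by (cases "j \<in> {1..n}") (auto simp: extensional_def)
    qed
    then show ?case
      using sol[of i] bcd_iterationD[OF iter, of i] by simp
  qed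
  then show "x' = x"
    using extensionalityI[OF bcd_iteration_extensional[OF iter] bcd_iteration_extensional[OF self]]
    by simp
qed (use self in simp)

lemma bcd_sequence_stops:
  assumes labels: "\<And>i. i \<in> {1..n} \<Longrightarrow> finite (S i)"
    and bcd: "bcd_sequence n S \<C> f x"
  shows "\<exists>m. x (Suc m) = x m"
proof (rule ccontr)
  assume "\<not> ?thesis"
  then have neq: "x (Suc k) \<noteq> x k" for k by blast
  then have iter: "bcd_iteration n S \<C> f (x k) (x (Suc k))" for k
    using bcd unfolding bcd_sequence_def by metis
  then have discrete: "x (Suc k) \<in> feasible_discrete n S" for k
    by (rule bcd_iteration_feasible_discrete)
  \<comment> \<open>The index is shifted because \<open>x 0\<close> need not be discrete; the sign
    turns strict decrease into \<open>strict_mono\<close>.\<close>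
  define e where "e k = - energy S \<C> f (x (Suc k))" for k
  have "strict_mono e"
    unfolding strict_mono_Suc_iff e_def
    using bcd_iteration_energy_less[OF iter discrete neq] by simp
  then have "inj e" by (rule strict_mono_imp_inj_on)
  then have "inj (\<lambda>k. x (Suc k))"
    by (simp add: e_def inj_def)
  moreover have "finite (range (\<lambda>k. x (Suc k)))"
  proof (rule finite_subset)
    show "range (\<lambda>k. x (Suc k)) \<subseteq> feasible_discrete n S"
      using discrete by blast
    show "finite (feasible_discrete n S)"
      using labels by (rule finite_feasible_discrete)
  qed
  ultimately show False
    by (simp add: finite_image_iff)
qed

theorem proposition1:
  fixes n :: nat
    and S :: "nat \<Rightarrow> 'l set"
    and \<C> :: "nat list set"
    and f :: "nat list \<Rightarrow> 'l list \<Rightarrow> real"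
    and x :: "nat \<Rightarrow> nat \<Rightarrow> 'l \<Rightarrow> real"
  assumes labels: "\<And>i. i \<in> {1..n} \<Longrightarrow> finite (S i) \<and> S i \<noteq> {}"
    and finite_cliques: "finite \<C>"
    and cliques: "\<And>C. C \<in> \<C> \<Longrightarrow> C \<noteq> [] \<and> distinct C \<and> set C \<subseteq> {1..n}"
    and single_nodes: "\<And>i. i \<in> {1..n} \<Longrightarrow> [i] \<in> \<C>"
    and initial: "x 0 \<in> feasible n S"
    and bcd: "bcd_sequence n S \<C> f x"
  shows "\<exists>x_star \<in> feasible_discrete n S. x \<longlonglongrightarrow> x_star \<and> bcd_fixed_point n S \<C> f x_star"
proof -
  \<comment> \<open>Minimality of \<open>m\<close> ensures that the step from \<open>x m\<close> is
    a genuine iteration and not the freezing clause of the sequence.\<close>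
  define m where "m = (LEAST m. x (Suc m) = x m)"
  have "\<exists>m. x (Suc m) = x m"
    using labels bcd by (blast intro: bcd_sequence_stops)
  then have stop: "x (Suc m) = x m"
    unfolding m_def by (rule LeastI_ex)
  have "\<not> (\<exists>l<m. x (Suc l) = x l)"
    unfolding m_def using not_less_Least by blast
  then have self: "bcd_iteration n S \<C> f (x m) (x m)"
    using bcd[unfolded bcd_sequence_def, rule_format, of m] stop by (simp split: if_splits)
  \<comment> \<open>The freezing clause looks only at strictly earlier indices, so the step at
    \<open>m\<close> itself comes from \<open>stop\<close>, all later ones from the clause.\<close>
  have const: "x (m + k) = x m" for k
  proof (induction k)
    case (Suc k)
    show ?case
    proof (cases "k = 0")
      case True
      with stop show ?thesis by simp
    next
      case False
      then have "\<exists>l<m + k. x (Suc l) = x l"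
        using stop by (intro exI[of _ m]) simp
      then have "x (Suc (m + k)) = x (m + k)"
        using bcd[unfolded bcd_sequence_def, rule_format, of "m + k"] by (simp only: if_True)
      with Suc.IH show ?thesis by simp
    qed
  qed simp
  have "eventually (\<lambda>k. x k = x m) sequentially"
    unfolding eventually_sequentially
  proof (intro exI allI impI)
    fix k
    assume "m \<le> k"
    then show "x k = x m" using const[of "k - m"] by simp
  qed
  then have "x \<longlonglongrightarrow> x m"
    by (rule tendsto_eventually)
  \<comment> \<open>As the output of an iteration from itself, \<open>x m\<close> is discrete even
    when \<open>m\<close> is 0.\<close>
  then show ?thesis
    using bcd_iteration_feasible_discrete[OF self] bcd_iteration_self_fixed_point[OF self]
    by blast
qed

end
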